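(* Let $T_m$ be the number of different ways in which a parallelepiped (tower) with sizes $2\times 2\times m$ can be filled with domino bricks of sizes $1\times 1\times 2$, let $A_n$ be the number of domino tilings of the $3\times 2n$ rectangular grid, and let $B_n$ be the number of domino tilings of the $3\times(2n+1)$ rectangular grid with one corner square removed. Then for every positive integer $n$, $$T_{2n}=A_n^2,\qquad T_{2n+1}=2B_n^2 .$$
   Context: Planar tilings: identify unit squares with points $(i,j)\in\mathbb{Z}^2$. A domino is a pair of unit squares sharing an edge, and a domino tiling of a finite set of squares is a partition of it into dominoes. $A_n$ is the number of domino tilings of $\{1,\dots,2n\}\times\{1,2,3\}$, and $B_n$ is the number of domino tilings of $\bigl(\{1,\dots,2n+1\}\times\{1,2,3\}\bigr)\setminus\{(1,3)\}$. Tower: identify the unit cubes of the $2\times2\times m$ tower with the points of $\{1,2\}\times\{1,2\}\times\{1,\dots,m\}\subset\mathbb{Z}^3$. A domino brick is a $1\times1\times2$ parallelepiped in any of the three axis-parallel orientations, i.e. a pair of unit cubes sharing a face (two points differing by $1$ in exactly one coordinate). A filling of the tower is a partition of its set of unit cubes into domino bricks. All tilings and fillings are counted as distinct partitions (no identification under symmetry). *)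

theory Defs
  imports Complex_Main "HOL-Library.Disjoint_Sets"
begin

text \<open>Unit squares and unit cubes are identified with points of the integer lattice. Dominoes and
  bricks are unordered pairs, i.e. two-element sets of such points.\<close>

definition domino :: "(int \<times> int) set \<Rightarrow> bool" where
  "domino d \<longleftrightarrow> (\<exists>x y x' y'. d = {(x, y), (x', y')} \<and>
     (\<bar>x - x'\<bar> = 1 \<and> y = y' \<or> x = x' \<and> \<bar>y - y'\<bar> = 1))"

definition brick :: "(int \<times> int \<times> int) set \<Rightarrow> bool" where
  "brick d \<longleftrightarrow> (\<exists>x y z x' y' z'. d = {(x, y, z), (x', y', z')} \<and>
     (\<bar>x - x'\<bar> = 1 \<and> y = y' \<and> z = z' \<or>
      x = x' \<and> \<bar>y - y'\<bar> = 1 \<and> z = z' \<or>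
      x = x' \<and> y = y' \<and> \<bar>z - z'\<bar> = 1))"

definition tilings :: "('a set \<Rightarrow> bool) \<Rightarrow> 'a set \<Rightarrow> 'a set set set" where
  "tilings tile S = {P. partition_on S P \<and> (\<forall>d\<in>P. tile d)}"

lemma finite_tilings: "finite S \<Longrightarrow> finite (tilings tile S)"
  by (rule finite_subset[of _ "Pow (Pow S)"]) (auto simp: tilings_def partition_on_def)

definition tower :: "nat \<Rightarrow> (int \<times> int \<times> int) set" where
  "tower m = {1, 2} \<times> {1, 2} \<times> {1..int m}"

definition T :: "nat \<Rightarrow> nat" where
  "T m = card (tilings brick (tower m))"

definition A :: "nat \<Rightarrow> nat" where
  "A n = card (tilings domino ({1..2 * int n} \<times> {1, 2, 3}))"

definition B :: "nat \<Rightarrow> nat" where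
  "B n = card (tilings domino ({1..2 * int n + 1} \<times> {1, 2, 3} - {(1, 3)}))"

end

theory Submission
  imports Defs
begin

text \<open>
  View a region as a family of columns of unit cells standing over the vertices of a small graph: a
  tile joins two consecutive cells of one column, or two cells of equal height in columns over
  adjacent vertices. The tower is such a region over a 4-cycle, and the grid with three rows is one
  over a path with three vertices. If a column is at least as high as its neighbours, then
  any tile through its top cell leaves again a region of this kind, described by new heights
  (\<open>stack_count_peel\<close>). All counts can therefore be computed by peeling off top cells.

  Write \<open>C m\<close> for the number of fillings of a tower of height \<open>m\<close> with two adjacent extra cubes on
  top. Peeling gives
    \<open>A (n + 1) = A n + 2 * B n\<close>, \<open>B (n + 1) = A (n + 1) + B n\<close>,
    \<open>T (m + 2) = T m + 2 * T (m + 1) + 4 * C m\<close>, \<open>C (m + 1) = T (m + 1) + C m\<close>.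
  Hence \<open>B n\<close> and \<open>C m\<close> are the partial sums of \<open>A\<close> and \<open>T\<close> (\<open>path_count_notched\<close>,
  \<open>cycle_count_half\<close>); the factors 2 and 4 appear because a partial sum does not see on which side
  the notch, or the extra pair of cubes, lies.

  The recurrences determine everything, and one induction (\<open>squares_of_recurrence\<close>) shows
  \<open>T (2 * n) = (A n)\<^sup>2\<close> and \<open>T (2 * n + 1) = 2 * (B n)\<^sup>2\<close>. The statement that makes it go
  through is \<open>C (2 * n) = A n * B n\<close>: it turns the right-hand sides for \<open>T\<close> into the expanded
  squares \<open>(A n + 2 * B n)\<^sup>2\<close> and \<open>2 * (A (n + 1) + B n)\<^sup>2\<close>.
\<close>

section \<open>Counting tilings\<close>

text \<open>Classify the tilings by the unique tile that covers a chosen cell.\<close>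

lemma tilings_by_cell:
  assumes "c \<in> S"
  shows "tilings tile S = (\<Union>d\<in>{d. tile d \<and> c \<in> d \<and> d \<subseteq> S}. insert d ` tilings tile (S - d))"
proof (intro equalityI subsetI)
  fix P assume P: "P \<in> tilings tile S"
  then have part: "partition_on S P" and tile: "\<forall>d\<in>P. tile d"
    by (auto simp: tilings_def)
  from part assms obtain d where d: "d \<in> P" "c \<in> d"
    by (auto simp: partition_on_def)
  have P_split: "P = insert d (P - {d})"
    using d by blast
  moreover have "disjnt d (\<Union>(P - {d}))"
    using part d(1) by (auto simp: partition_on_def disjoint_def disjnt_def)
  ultimately have "partition_on (S - d) (P - {d})"
    using part by (metis partition_on_insert)
  with tile have "P - {d} \<in> tilings tile (S - d)"
    by (simp add: tilings_def)
  moreover have "d \<subseteq> S"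
    using d part by (auto simp: partition_on_def)
  ultimately show "P \<in> (\<Union>d\<in>{d. tile d \<and> c \<in> d \<and> d \<subseteq> S}. insert d ` tilings tile (S - d))"
    using d tile P_split by blast
next
  fix P assume "P \<in> (\<Union>d\<in>{d. tile d \<and> c \<in> d \<and> d \<subseteq> S}. insert d ` tilings tile (S - d))"
  then obtain d Q where d: "tile d" "c \<in> d" "d \<subseteq> S" and Q: "Q \<in> tilings tile (S - d)"
    and P: "P = insert d Q" by blast
  have "partition_on (S - d) Q"
    using Q by (simp add: tilings_def)
  moreover from this have "disjnt d (\<Union>Q)"
    by (auto simp: partition_on_def disjnt_def)
  ultimately have "partition_on S P"
    using d by (auto simp: P partition_on_insert)
  with Q d show "P \<in> tilings tile S"
    by (auto simp: tilings_def P)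
qed

lemma card_tilings_by_cell:
  assumes "finite S" and c: "c \<in> S"
  shows "card (tilings tile S) =
    (\<Sum>d\<in>{d. tile d \<and> c \<in> d \<and> d \<subseteq> S}. card (tilings tile (S - d)))"
proof -
  let ?D = "{d. tile d \<and> c \<in> d \<and> d \<subseteq> S}"
  have notin: "e \<notin> Q" if "Q \<in> tilings tile (S - d)" "c \<in> d" "c \<in> e" for d e Q
    using that by (auto simp: tilings_def partition_on_def)
  have "finite ?D"
    by (rule finite_subset[of _ "Pow S"]) (use assms in auto)
  moreover have "finite (insert d ` tilings tile (S - d))" for d
    using assms(1) by (simp add: finite_tilings)
  moreover have "insert d ` tilings tile (S - d) \<inter> insert e ` tilings tile (S - e) = {}"
    if "d \<in> ?D" "e \<in> ?D" "d \<noteq> e" for d e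
    using that notin[of _ d e] by blast
  ultimately have "card (tilings tile S) = (\<Sum>d\<in>?D. card (insert d ` tilings tile (S - d)))"
    unfolding tilings_by_cell[OF c] by (subst card_UN_disjoint) auto
  also have "inj_on (insert d) (tilings tile (S - d))" if "d \<in> ?D" for d
    using that notin[of _ d d] by (auto intro!: inj_onI simp: insert_ident)
  then have "(\<Sum>d\<in>?D. card (insert d ` tilings tile (S - d))) = (\<Sum>d\<in>?D. card (tilings tile (S - d)))"
    by (intro sum.cong refl card_image) auto
  finally show ?thesis .
qed

definition pair_tile :: "('a \<Rightarrow> 'a \<Rightarrow> bool) \<Rightarrow> 'a set \<Rightarrow> bool" where
  "pair_tile R d \<longleftrightarrow> (\<exists>p q. d = {p, q} \<and> R p q)"

text \<open>Counts carry over along an injection that preserves and reflects adjacency. This lets the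
  lattice regions be replaced by stacks of columns.\<close>

lemma card_tilings_image:
  assumes inj: "inj f" and R: "\<And>p q. p \<in> S \<Longrightarrow> q \<in> S \<Longrightarrow> R' (f p) (f q) \<longleftrightarrow> R p q"
  shows "card (tilings (pair_tile R') (f ` S)) = card (tilings (pair_tile R) S)"
proof -
  have tile: "pair_tile R' (f ` d) \<longleftrightarrow> pair_tile R d" if "d \<subseteq> S" for d
  proof
    assume "pair_tile R' (f ` d)"
    then obtain p' q' where pq: "f ` d = {p', q'}" "R' p' q'"
      by (auto simp: pair_tile_def)
    then obtain p q where "p \<in> d" "q \<in> d" "p' = f p" "q' = f q"
      by (metis imageE insertI1 insert_commute)
    moreover from this pq(1) have "f ` d = f ` {p, q}" by simp
    then have "d = {p, q}" using inj by (simp only: inj_image_eq_iff)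
    ultimately show "pair_tile R d"
      using that pq R by (auto simp: pair_tile_def)
  qed (use that R in \<open>fastforce simp: pair_tile_def\<close>)
  have part: "partition_on (f ` S) ((`) f ` P) \<longleftrightarrow> partition_on S P" for P
  proof -
    have "\<Union>((`) f ` P) = f ` \<Union>P" by blast
    then show ?thesis
      using inj unfolding partition_on_def disjoint_def
      by (auto simp: inj_image_eq_iff image_Int[symmetric])
  qed
  have "tilings (pair_tile R') (f ` S) = (`) ((`) f) ` tilings (pair_tile R) S" (is "?L = ?R")
  proof (intro equalityI subsetI)
    fix Q assume Q: "Q \<in> ?L"
    define P where "P = {d. d \<subseteq> S \<and> f ` d \<in> Q}"
    have "\<And>e. e \<in> Q \<Longrightarrow> e \<subseteq> f ` S"
      using Q by (auto simp: tilings_def partition_on_def)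
    then have "Q = (`) f ` P"
      by (fastforce simp: P_def subset_image_iff)
    moreover from this Q have "partition_on S P"
      using part by (simp add: tilings_def)
    then have "P \<in> tilings (pair_tile R) S"
      using Q tile by (auto simp: tilings_def P_def)
    ultimately show "Q \<in> ?R" by blast
  next
    fix Q assume "Q \<in> ?R"
    then obtain P where "Q = (`) f ` P" "P \<in> tilings (pair_tile R) S" by blast
    then show "Q \<in> ?L"
      using part tile by (auto simp: tilings_def partition_on_def[of S])
  qed
  moreover have "inj ((`) ((`) f))"
    using inj by (simp add: inj_image_eq_iff inj_on_def)
  ultimately show ?thesis
    by (metis card_image inj_on_subset subset_UNIV)
qed

section \<open>Columns over a graph\<close>

text \<open>The second component of a cell is its height within its column, counted from 0.\<close>

definition stack_adj :: "('v \<Rightarrow> 'v \<Rightarrow> bool) \<Rightarrow> 'v \<times> nat \<Rightarrow> 'v \<times> nat \<Rightarrow> bool" where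
  "stack_adj E = (\<lambda>(u, i) (v, j). u = v \<and> (j = Suc i \<or> i = Suc j) \<or> E u v \<and> i = j)"

definition stack :: "'v set \<Rightarrow> ('v \<Rightarrow> nat) \<Rightarrow> ('v \<times> nat) set" where
  "stack V h = (SIGMA v:V. {..<h v})"

definition stack_count :: "'v set \<Rightarrow> ('v \<Rightarrow> 'v \<Rightarrow> bool) \<Rightarrow> ('v \<Rightarrow> nat) \<Rightarrow> nat" where
  "stack_count V E h = card (tilings (pair_tile (stack_adj E)) (stack V h))"

lemma stack_count_empty:
  assumes "\<And>v. v \<in> V \<Longrightarrow> h v = 0"
  shows "stack_count V E h = 1"
proof -
  have "stack V h = {}" using assms by (auto simp: stack_def)
  then have "tilings (pair_tile (stack_adj E)) (stack V h) = {{}}"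
    by (auto simp: tilings_def partition_on_def)
  then show ?thesis by (simp add: stack_count_def)
qed

text \<open>The tile through the top cell of column \<open>c\<close> either goes one cell down, or sideways to a
  neighbouring column. As no neighbour exceeds \<open>c\<close>, the sideways partner is the top cell of
  its own column, so that in either case what remains is again a stack.\<close>

lemma stack_count_peel:
  assumes V: "finite V" "c \<in> V" and E: "symp E" "irreflp E"
    and top: "h c = Suc k" and max: "\<And>v. v \<in> V \<Longrightarrow> E c v \<Longrightarrow> h v \<le> Suc k"
  shows "stack_count V E h = (if k = 0 then 0 else stack_count V E (h(c := k - 1))) +
    (\<Sum>v\<in>V. if E c v \<and> h v = Suc k then stack_count V E (h(c := k, v := k)) else 0)"
proof -
  let ?S = "stack V h" and ?N = "{v \<in> V. E c v \<and> h v = Suc k}"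
  let ?tile = "pair_tile (stack_adj E)"
  let ?D = "{d. ?tile d \<and> (c, k) \<in> d \<and> d \<subseteq> ?S}"
  let ?X = "if k = 0 then {} else {{(c, k), (c, k - 1)}}" and ?f = "\<lambda>v. {(c, k), (v, k)}"
  have cn: "\<not> E c c" using E(2) by (simp add: irreflp_def)
  have fin: "finite ?S" using V by (simp add: stack_def)
  have mem: "(v, i) \<in> ?S \<longleftrightarrow> v \<in> V \<and> i < h v" for v i by (simp add: stack_def)
  have D: "?D = ?X \<union> ?f ` ?N"
  proof (intro equalityI subsetI)
    fix d assume d: "d \<in> ?D"
    then obtain p q where pq: "d = {p, q}" "stack_adj E p q" by (auto simp: pair_tile_def)
    have "\<exists>v j. d = {(c, k), (v, j)} \<and> stack_adj E (c, k) (v, j)"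
    proof (cases "p = (c, k)")
      case True
      with pq show ?thesis by (cases q) auto
    next
      case False
      with d pq have "q = (c, k)" by auto
      moreover have "stack_adj E q p"
        using pq(2) E(1) by (auto simp: stack_adj_def symp_def split: prod.splits)
      ultimately show ?thesis
        using pq(1) by (cases p) auto
    qed
    then obtain v j where vj: "d = {(c, k), (v, j)}" "stack_adj E (c, k) (v, j)" by blast
    with d have "v \<in> V" "j < h v" by (auto simp: mem)
    with vj max[of v] top show "d \<in> ?X \<union> ?f ` ?N"
      by (auto simp: stack_adj_def)
  next
    fix d assume "d \<in> ?X \<union> ?f ` ?N"
    then consider "k \<noteq> 0" "d = {(c, k), (c, k - 1)}" | v where "v \<in> ?N" "d = ?f v"
      by (auto split: if_splits)
    then show "d \<in> ?D"
    proof cases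
      case 1
      then have "stack_adj E (c, k) (c, k - 1)" by (simp add: stack_adj_def)
      with 1 have "?tile d" unfolding pair_tile_def by blast
      with 1 show ?thesis
        using V top by (simp add: mem)
    next
      case 2
      then show ?thesis
        using V top by (auto simp: pair_tile_def stack_adj_def mem)
    qed
  qed
  have "stack_count V E h = (\<Sum>d\<in>?X \<union> ?f ` ?N. card (tilings ?tile (?S - d)))"
    unfolding stack_count_def using card_tilings_by_cell[OF fin, of "(c, k)" ?tile] V top
    by (simp add: mem D del: Un_insert_left)
  also have "\<dots> = (\<Sum>d\<in>?X. card (tilings ?tile (?S - d))) +
      (\<Sum>d\<in>?f ` ?N. card (tilings ?tile (?S - d)))"
    using V cn by (intro sum.union_disjoint) (auto simp: doubleton_eq_iff)
  also have "(\<Sum>d\<in>?X. card (tilings ?tile (?S - d))) = (if k = 0 then 0 else stack_count V E (h(c := k - 1)))"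
  proof -
    have "?S - {(c, k), (c, k - 1)} = stack V (h(c := k - 1))" if "k \<noteq> 0"
      using that top by (auto simp: stack_def split: if_splits)
    then show ?thesis by (simp add: stack_count_def)
  qed
  also have "(\<Sum>d\<in>?f ` ?N. card (tilings ?tile (?S - d))) =
      (\<Sum>v\<in>?N. card (tilings ?tile (?S - ?f v)))"
    by (subst sum.reindex) (auto simp: inj_on_def doubleton_eq_iff)
  also have "\<dots> = (\<Sum>v\<in>?N. stack_count V E (h(c := k, v := k)))"
  proof (rule sum.cong)
    fix v assume v: "v \<in> ?N"
    with cn have "v \<noteq> c" by auto
    with v top have "?S - ?f v = stack V (h(c := k, v := k))"
      by (auto simp: stack_def split: if_splits)
    then show "card (tilings ?tile (?S - ?f v)) = stack_count V E (h(c := k, v := k))"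
      by (simp add: stack_count_def)
  qed simp
  also have "\<dots> = (\<Sum>v\<in>V. if E c v \<and> h v = Suc k then stack_count V E (h(c := k, v := k)) else 0)"
    using V by (subst sum.inter_filter[symmetric]) auto
  finally show ?thesis .
qed

section \<open>Three columns in a row\<close>

definition path3 where
  "path3 V E a b c \<longleftrightarrow> V = {a, b, c} \<and> distinct [a, b, c] \<and> symp E \<and> irreflp E \<and>
     E a b \<and> E b c \<and> \<not> E a c"

definition path_count where
  "path_count V E a b c i j k = stack_count V E ((\<lambda>_. 0)(a := i, b := j, c := k))"

lemma path3_rev: "path3 V E a b c \<Longrightarrow> path3 V E c b a"
  by (auto simp: path3_def symp_def)

lemma path_count_rev: "path3 V E a b c \<Longrightarrow> path_count V E a b c i j k = path_count V E c b a k j i"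
  unfolding path_count_def by (rule arg_cong[where f = "stack_count V E"]) (auto simp: path3_def)

lemma path_count_0: "path3 V E a b c \<Longrightarrow> path_count V E a b c 0 0 0 = 1"
  unfolding path_count_def by (rule stack_count_empty) auto

lemma path_count_peel_first:
  assumes P: "path3 V E a b c" and "j \<le> Suc i"
  shows "path_count V E a b c (Suc i) j k = (if i = 0 then 0 else path_count V E a b c (i - 1) j k) +
    (if j = Suc i then path_count V E a b c i i k else 0)"
proof -
  have d: "a \<noteq> b" "a \<noteq> c" "b \<noteq> c" "b \<noteq> a" "c \<noteq> a" "c \<noteq> b" "\<not> E a c" "E a b" "\<not> E a a"
    using P by (auto simp: path3_def irreflp_def)
  define H where "H i j k = (\<lambda>_. 0 :: nat)(a := i, b := j, c := k)" for i j k
  have upd: "(H i j k)(a := x) = H x j k" "(H i j k)(b := x) = H i x k"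
      "(H i j k)(c := x) = H i j x" for i j k x
    using d by (auto simp: H_def)
  have val: "H i j k a = i" "H i j k b = j" "H i j k c = k" for i j k
    using d by (auto simp: H_def)
  have "stack_count V E (H (Suc i) j k) = (if i = 0 then 0 else stack_count V E ((H (Suc i) j k)(a := i - 1))) +
      (\<Sum>v\<in>V. if E a v \<and> H (Suc i) j k v = Suc i
        then stack_count V E ((H (Suc i) j k)(a := i, v := i)) else 0)"
    using assms d by (intro stack_count_peel) (auto simp: path3_def val)
  then show ?thesis
    using P d by (simp add: path3_def path_count_def H_def[symmetric] upd val)
qed

lemma path_count_peel_middle:
  assumes P: "path3 V E a b c" and "i \<le> Suc j" "k \<le> Suc j"
  shows "path_count V E a b c i (Suc j) k = (if j = 0 then 0 else path_count V E a b c i (j - 1) k) +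
    (if i = Suc j then path_count V E a b c j j k else 0) + (if k = Suc j then path_count V E a b c i j j else 0)"
proof -
  have d: "a \<noteq> b" "a \<noteq> c" "b \<noteq> c" "b \<noteq> a" "c \<noteq> a" "c \<noteq> b" "E b c" "E b a" "\<not> E b b"
    using P by (auto simp: path3_def irreflp_def symp_def)
  define H where "H i j k = (\<lambda>_. 0 :: nat)(a := i, b := j, c := k)" for i j k
  have upd: "(H i j k)(a := x) = H x j k" "(H i j k)(b := x) = H i x k"
      "(H i j k)(c := x) = H i j x" for i j k x
    using d by (auto simp: H_def)
  have val: "H i j k a = i" "H i j k b = j" "H i j k c = k" for i j k
    using d by (auto simp: H_def)
  have "stack_count V E (H i (Suc j) k) = (if j = 0 then 0 else stack_count V E ((H i (Suc j) k)(b := j - 1))) +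
      (\<Sum>v\<in>V. if E b v \<and> H i (Suc j) k v = Suc j
        then stack_count V E ((H i (Suc j) k)(b := j, v := j)) else 0)"
    using assms d by (intro stack_count_peel) (auto simp: path3_def val)
  then show ?thesis
    using P d by (simp add: path3_def path_count_def H_def[symmetric] upd val)
qed

lemma path_count_peel_last:
  assumes P: "path3 V E a b c" and "j \<le> Suc k"
  shows "path_count V E a b c i j (Suc k) = (if k = 0 then 0 else path_count V E a b c i j (k - 1)) +
    (if j = Suc k then path_count V E a b c i k k else 0)"
  using path_count_peel_first[OF path3_rev[OF P]] assms by (simp add: path_count_rev[OF P])

text \<open>Look at the tile on the top cell of the first column. If it reaches the second column, the
  full stack of height \<open>2 * n\<close> remains; if it is vertical, then vertical tiles are forced on the other
  two columns as well, and the same shape remains with all heights lowered by 2.\<close>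

lemma path_count_notched:
  assumes P: "path3 V E a b c"
  shows "path_count V E a b c (2 * n + 1) (2 * n + 1) (2 * n) = (\<Sum>i\<le>n. path_count V E a b c (2 * i) (2 * i) (2 * i))"
proof (induction n)
  case 0
  then show ?case using P by (simp add: path_count_peel_first path_count_0)
next
  case (Suc n)
  let ?m = "2 * n"
  have "path_count V E a b c (2 * Suc n + 1) (2 * Suc n + 1) (2 * Suc n) =
     path_count V E a b c (?m + 1) (?m + 3) (?m + 2) + path_count V E a b c (?m + 2) (?m + 2) (?m + 2)"
    using path_count_peel_first[OF P, of "?m + 3" "?m + 2" "?m + 2"] by (simp add: eval_nat_numeral)
  also have "path_count V E a b c (?m + 1) (?m + 3) (?m + 2) = path_count V E a b c (?m + 1) (?m + 1) (?m + 2)"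
    using path_count_peel_middle[OF P, of "?m + 1" "?m + 2" "?m + 2"] by (simp add: eval_nat_numeral)
  also have "\<dots> = path_count V E a b c (?m + 1) (?m + 1) ?m"
    using path_count_peel_last[OF P, of "?m + 1" "?m + 1" "?m + 1"] by (simp add: eval_nat_numeral)
  finally show ?case using Suc by simp
qed

text \<open>The three terms correspond to the shapes of the top: vertical tiles only, or one horizontal tile
  across the last two or the first two columns.\<close>

lemma path_count_full:
  assumes P: "path3 V E a b c"
  shows "path_count V E a b c (m + 2) (m + 2) (m + 2) = path_count V E a b c m m m +
     path_count V E a b c m (m + 1) (m + 1) + path_count V E a b c (m + 1) (m + 1) m"
proof -
  have "path_count V E a b c (m + 2) (m + 2) (m + 2) =
     path_count V E a b c m (m + 2) (m + 2) + path_count V E a b c (m + 1) (m + 1) (m + 2)"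
    using path_count_peel_first[OF P, of "m + 2" "m + 1" "m + 2"] by (simp add: eval_nat_numeral)
  also have "path_count V E a b c (m + 1) (m + 1) (m + 2) = path_count V E a b c (m + 1) (m + 1) m"
    using path_count_peel_last[OF P, of "m + 1" "m + 1" "m + 1"] by (simp add: eval_nat_numeral)
  also have "path_count V E a b c m (m + 2) (m + 2) =
     path_count V E a b c m m (m + 2) + path_count V E a b c m (m + 1) (m + 1)"
    using path_count_peel_middle[OF P, of m "m + 1" "m + 2"] by (simp add: eval_nat_numeral)
  also have "path_count V E a b c m m (m + 2) = path_count V E a b c m m m"
    using path_count_peel_last[OF P, of m "m + 1" m] by (simp add: eval_nat_numeral)
  finally show ?thesis by simp
qed

section \<open>Four columns in a cycle\<close>

definition cycle4 where
  "cycle4 V E a b c d \<longleftrightarrow> V = {a, b, c, d} \<and> distinct [a, b, c, d] \<and> symp E \<and> irreflp E \<and>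
     E a b \<and> E b c \<and> E c d \<and> E d a \<and> \<not> E a c \<and> \<not> E b d"

definition cycle_count where
  "cycle_count V E a b c d i j k l = stack_count V E ((\<lambda>_. 0)(a := i, b := j, c := k, d := l))"

lemma cycle4_rotate: "cycle4 V E a b c d \<Longrightarrow> cycle4 V E b c d a"
  by (auto simp: cycle4_def symp_def)

text \<open>Rotation invariance allows one to prove the peeling rule and the count with a half-filled top
  layer for a single position on the cycle.\<close>

lemma cycle_count_rotate: "cycle4 V E a b c d \<Longrightarrow> cycle_count V E a b c d i j k l = cycle_count V E b c d a j k l i"
  unfolding cycle_count_def by (rule arg_cong[where f = "stack_count V E"]) (auto simp: cycle4_def)

lemma cycle_count_0: "cycle4 V E a b c d \<Longrightarrow> cycle_count V E a b c d 0 0 0 0 = 1"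
  unfolding cycle_count_def by (rule stack_count_empty) auto

lemma cycle_count_peel_first:
  assumes C: "cycle4 V E a b c d" and "j \<le> Suc i" "l \<le> Suc i"
  shows "cycle_count V E a b c d (Suc i) j k l = (if i = 0 then 0 else cycle_count V E a b c d (i - 1) j k l) +
    (if j = Suc i then cycle_count V E a b c d i i k l else 0) + (if l = Suc i then cycle_count V E a b c d i j k i else 0)"
proof -
  have ne: "distinct [a, b, c, d]" and ed: "E a b" "E a d" "\<not> E a a" "\<not> E a c"
    using C by (auto simp: cycle4_def irreflp_def symp_def)
  define H where "H i j k l = (\<lambda>_. 0 :: nat)(a := i, b := j, c := k, d := l)" for i j k l
  have upd: "(H i j k l)(a := x) = H x j k l" "(H i j k l)(b := x) = H i x k l"
      "(H i j k l)(d := x) = H i j k x" for i j k l x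
    using ne by (auto simp: H_def)
  have val: "H i j k l a = i" "H i j k l b = j" "H i j k l d = l" for i j k l
    using ne by (auto simp: H_def)
  have "stack_count V E (H (Suc i) j k l) = (if i = 0 then 0 else stack_count V E ((H (Suc i) j k l)(a := i - 1))) +
      (\<Sum>v\<in>V. if E a v \<and> H (Suc i) j k l v = Suc i
        then stack_count V E ((H (Suc i) j k l)(a := i, v := i)) else 0)"
    using assms ne ed by (intro stack_count_peel) (auto simp: cycle4_def val)
  then show ?thesis
    using C ne ed by (simp add: cycle4_def cycle_count_def H_def[symmetric] upd val)
qed

lemma cycle_count_peel_second:
  assumes C: "cycle4 V E a b c d" and "i \<le> Suc j" "k \<le> Suc j"
  shows "cycle_count V E a b c d i (Suc j) k l = (if j = 0 then 0 else cycle_count V E a b c d i (j - 1) k l) +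
    (if k = Suc j then cycle_count V E a b c d i j j l else 0) + (if i = Suc j then cycle_count V E a b c d j j k l else 0)"
  using cycle_count_peel_first[OF cycle4_rotate[OF C] assms(3,2), of l] by (simp add: cycle_count_rotate[OF C])

text \<open>A tile across the two raised columns leaves a full stack. Otherwise both carry vertical tiles, and
  then the opposite two columns are the raised ones: the induction has to run over all rotations of
  the cycle at once.\<close>

lemma cycle_count_half:
  assumes C: "cycle4 V E a b c d"
  shows "cycle_count V E a b c d (m + 1) (m + 1) m m = (\<Sum>i\<le>m. cycle_count V E a b c d i i i i)"
  using C
proof (induction m arbitrary: a b c d)
  case 0
  then show ?case by (simp add: cycle_count_peel_first cycle_count_0)
next
  case (Suc m)
  note C = Suc.prems and C2 = cycle4_rotate[OF Suc.prems]
  note C3 = cycle4_rotate[OF C2]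
  note rotate = cycle_count_rotate[OF C] cycle_count_rotate[OF C2]
  have "cycle_count V E a b c d (Suc m + 1) (Suc m + 1) (Suc m) (Suc m) =
    cycle_count V E a b c d m (m + 2) (m + 1) (m + 1) + cycle_count V E a b c d (m + 1) (m + 1) (m + 1) (m + 1)"
    using cycle_count_peel_first[OF C, of "m + 2" "m + 1" "m + 1" "m + 1"] by (simp add: eval_nat_numeral)
  also have "cycle_count V E a b c d m (m + 2) (m + 1) (m + 1) = cycle_count V E a b c d m m (m + 1) (m + 1)"
    using cycle_count_peel_second[OF C, of m "m + 1" "m + 1" "m + 1"] by (simp add: eval_nat_numeral)
  also have "\<dots> = cycle_count V E c d a b (m + 1) (m + 1) m m"
    by (simp only: rotate)
  also have "\<dots> = (\<Sum>i\<le>m. cycle_count V E a b c d i i i i)"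
    unfolding Suc.IH[OF C3] by (simp only: rotate)
  finally show ?case by simp
qed

lemma cycle_count_peel_third:
  assumes C: "cycle4 V E a b c d" and "j \<le> Suc k" "l \<le> Suc k"
  shows "cycle_count V E a b c d i j (Suc k) l = (if k = 0 then 0 else cycle_count V E a b c d i j (k - 1) l) +
    (if l = Suc k then cycle_count V E a b c d i j k k else 0) + (if j = Suc k then cycle_count V E a b c d i k k l else 0)"
  using cycle_count_peel_second[OF cycle4_rotate[OF C] assms(2,3), of i] by (simp add: cycle_count_rotate[OF C])

lemma cycle_count_peel_fourth:
  assumes C: "cycle4 V E a b c d" and "k \<le> Suc l" "i \<le> Suc l"
  shows "cycle_count V E a b c d i j k (Suc l) = (if l = 0 then 0 else cycle_count V E a b c d i j k (l - 1)) +
    (if i = Suc l then cycle_count V E a b c d l j k l else 0) + (if k = Suc l then cycle_count V E a b c d i j l l else 0)"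
  using cycle_count_peel_third[OF cycle4_rotate[OF C] assms(2,3), of j] by (simp add: cycle_count_rotate[OF C])

text \<open>The top layer is covered by vertical tiles only, by two parallel horizontal tiles (2 ways), or by one
  horizontal tile on an edge of the cycle (4 ways); in the last case the other two columns lose
  two cells each and the columns of that edge stand out as a half layer.\<close>

lemma cycle_count_full:
  assumes C: "cycle4 V E a b c d"
  defines "F \<equiv> cycle_count V E a b c d"
  shows "F (m + 2) (m + 2) (m + 2) (m + 2) = F m m m m + 2 * F (m + 1) (m + 1) (m + 1) (m + 1) +
     4 * (\<Sum>i\<le>m. F i i i i)"
proof -
  note peel = cycle_count_peel_first[OF C, folded F_def] cycle_count_peel_second[OF C, folded F_def]
    cycle_count_peel_third[OF C, folded F_def] cycle_count_peel_fourth[OF C, folded F_def]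
  let ?k = "m + 1" and ?l = "m + 2"
  have "F ?l ?l ?l ?l = F m ?l ?l ?l + F ?k ?k ?l ?l + F ?k ?l ?l ?k"
    using peel(1)[of ?l ?k ?l ?l] by simp
  also have "F m ?l ?l ?l = F m m ?l ?l + F m ?k ?k ?l"
    using peel(2)[of m ?k ?l ?l] by simp
  also have "F m m ?l ?l = F m m m ?l + F m m ?k ?k"
    using peel(3)[of m ?k ?l m] by simp
  also have "F m m m ?l = F m m m m"
    using peel(4)[of m ?k m m] by simp
  also have "F m ?k ?k ?l = F m ?k ?k m"
    using peel(4)[of ?k ?k m ?k] by simp
  also have "F ?k ?k ?l ?l = F ?k ?k m ?l + F ?k ?k ?k ?k"
    using peel(3)[of ?k ?k ?l ?k] by simp
  also have "F ?k ?k m ?l = F ?k ?k m m"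
    using peel(4)[of m ?k ?k ?k] by simp
  also have "F ?k ?l ?l ?k = F ?k m ?l ?k + F ?k ?k ?k ?k"
    using peel(2)[of ?k ?k ?l ?k] by simp
  also have "F ?k m ?l ?k = F ?k m m ?k"
    using peel(3)[of m ?k ?k ?k] by simp
  finally have "F ?l ?l ?l ?l = F m m m m + 2 * F ?k ?k ?k ?k +
      (F m m ?k ?k + F m ?k ?k m + F ?k ?k m m + F ?k m m ?k)" by simp
  moreover have C2: "cycle4 V E b c d a" and C3: "cycle4 V E c d a b" and C4: "cycle4 V E d a b c"
    using C cycle4_rotate by metis+
  have r: "F i j k l = cycle_count V E b c d a j k l i" "F i j k l = cycle_count V E c d a b k l i j"
    "F i j k l = cycle_count V E d a b c l i j k" for i j k l
    using cycle_count_rotate C C2 C3 unfolding F_def by metis+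
  have "F ?k ?k m m = (\<Sum>i\<le>m. F i i i i)"
    using cycle_count_half[OF C] by (simp add: F_def)
  moreover have "F m ?k ?k m = (\<Sum>i\<le>m. F i i i i)"
    using cycle_count_half[OF C2] by (simp add: r(1))
  moreover have "F m m ?k ?k = (\<Sum>i\<le>m. F i i i i)"
    using cycle_count_half[OF C3] by (simp add: r(2))
  moreover have "F ?k m m ?k = (\<Sum>i\<le>m. F i i i i)"
    using cycle_count_half[OF C4] by (simp add: r(3))
  ultimately show ?thesis by simp
qed

section \<open>Squares from the recurrences\<close>

text \<open>Let \<open>b n\<close> be the partial sums of \<open>a\<close>. The partial sums of \<open>t\<close> up to \<open>2 * n\<close> are
  \<open>a n * b n\<close>; this is carried along in the induction because it supplies the mixed terms \<open>4 * a n * b n\<close> and \<open>4 * a (n + 1) * b n\<close> of the two squares.\<close>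

lemma squares_of_recurrence:
  fixes a t :: "nat \<Rightarrow> nat"
  assumes a: "a 0 = 1" "\<And>n. a (Suc n) = a n + 2 * (\<Sum>i\<le>n. a i)"
    and t: "t 0 = 1" "t 1 = 2" "\<And>m. t (m + 2) = t m + 2 * t (m + 1) + 4 * (\<Sum>i\<le>m. t i)"
  shows "t (2 * n) = (a n)\<^sup>2 \<and> t (2 * n + 1) = 2 * (\<Sum>i\<le>n. a i)\<^sup>2"
proof -
  define b where "b n = (\<Sum>i\<le>n. a i)" for n
  have b: "a (Suc n) = a n + 2 * b n" "b (Suc n) = a (Suc n) + b n" for n
    using a by (simp_all add: b_def)
  have "t (2 * n) = (a n)\<^sup>2 \<and> t (2 * n + 1) = 2 * (b n)\<^sup>2 \<and> (\<Sum>i\<le>2 * n. t i) = a n * b n"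
  proof (induction n)
    case 0
    then show ?case using a t by (simp add: b_def)
  next
    case (Suc n)
    then have IH: "t (2 * n) = (a n)\<^sup>2" "t (2 * n + 1) = 2 * (b n)\<^sup>2" "(\<Sum>i\<le>2 * n. t i) = a n * b n"
      by auto
    have even: "t (2 * n + 2) = (a (Suc n))\<^sup>2"
      unfolding t(3) IH b(1) by (simp add: power2_eq_square algebra_simps)
    have sum: "(\<Sum>i\<le>2 * n + 1. t i) = a (Suc n) * b n"
      using IH by (simp add: b(1) power2_eq_square algebra_simps)
    have "t (2 * n + 3) = t (2 * n + 1) + 2 * t (2 * n + 2) + 4 * (\<Sum>i\<le>2 * n + 1. t i)"
      using t(3)[of "2 * n + 1"] by (simp add: eval_nat_numeral)
    also have "\<dots> = 2 * (b (Suc n))\<^sup>2"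
      unfolding even sum IH b(2) by (simp add: power2_eq_square algebra_simps)
    finally have odd: "t (2 * n + 3) = 2 * (b (Suc n))\<^sup>2" .
    have "(\<Sum>i\<le>2 * n + 2. t i) = a (Suc n) * b (Suc n)"
      using sum even by (simp add: b(2) power2_eq_square algebra_simps)
    with even odd show ?case by (simp add: eval_nat_numeral)
  qed
  then show ?thesis by (simp add: b_def)
qed

section \<open>Grids and towers as stacks\<close>

abbreviation row_adj :: "int \<Rightarrow> int \<Rightarrow> bool" where
  "row_adj y y' \<equiv> \<bar>y - y'\<bar> = 1"

abbreviation square_adj :: "int \<times> int \<Rightarrow> int \<times> int \<Rightarrow> bool" where
  "square_adj \<equiv> \<lambda>(x, y) (x', y'). \<bar>x - x'\<bar> = 1 \<and> y = y' \<or> x = x' \<and> \<bar>y - y'\<bar> = 1"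

lemma path3_rows: "path3 {1, 2, 3} row_adj 1 2 3"
  by (auto simp: path3_def symp_def irreflp_def)

lemma cycle4_square: "cycle4 ({1, 2} \<times> {1, 2}) square_adj (1, 1) (1, 2) (2, 2) (2, 1)"
  by (auto simp: cycle4_def symp_def irreflp_def)

lemma domino_eq: "domino = pair_tile square_adj"
  by (auto simp: domino_def pair_tile_def fun_eq_iff)

lemma brick_eq: "brick = pair_tile (\<lambda>(x, y, z) (x', y', z').
     \<bar>x - x'\<bar> = 1 \<and> y = y' \<and> z = z' \<or>
      x = x' \<and> \<bar>y - y'\<bar> = 1 \<and> z = z' \<or>
      x = x' \<and> y = y' \<and> \<bar>z - z'\<bar> = 1)"
  by (auto simp: brick_def pair_tile_def fun_eq_iff)

text \<open>The rows of a grid become columns, with heights counted from the right edge \<open>x = N\<close>. With this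
  orientation, removing the corner \<open>(1, 3)\<close> just lowers the third column by one cell.\<close>

lemma card_tilings_domino:
  "card (tilings domino ((\<lambda>(y, i). (N - int i, y)) ` stack V h)) = stack_count V row_adj h"
  unfolding domino_eq stack_count_def
  by (rule card_tilings_image) (auto simp: stack_adj_def inj_on_def)

lemma A_eq: "A n = path_count {1, 2, 3} row_adj 1 2 3 (2 * n) (2 * n) (2 * n)"
proof -
  have "{1..2 * int n} \<times> {1, 2, 3 :: int} = (\<lambda>(y, i). (2 * int n - int i, y)) `
      stack {1, 2, 3} ((\<lambda>_. 0)(1 := 2 * n, 2 := 2 * n, 3 := 2 * n))"
    (is "_ = ?f ` ?S")
  proof (intro equalityI subsetI)
    fix p assume p: "p \<in> {1..2 * int n} \<times> {1, 2, 3 :: int}"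
    show "p \<in> ?f ` ?S"
      by (rule image_eqI[of _ _ "(snd p, nat (2 * int n - fst p))"]) (use p in \<open>auto simp: stack_def\<close>)
  qed (auto simp: stack_def)
  then show ?thesis
    unfolding A_def path_count_def by (simp only: card_tilings_domino)
qed

lemma B_eq: "B n = path_count {1, 2, 3} row_adj 1 2 3 (2 * n + 1) (2 * n + 1) (2 * n)"
proof -
  have "{1..2 * int n + 1} \<times> {1, 2, 3 :: int} - {(1, 3)} = (\<lambda>(y, i). (2 * int n + 1 - int i, y)) `
      stack {1, 2, 3} ((\<lambda>_. 0)(1 := 2 * n + 1, 2 := 2 * n + 1, 3 := 2 * n))"
    (is "_ = ?f ` ?S")
  proof (intro equalityI subsetI)
    fix p assume p: "p \<in> {1..2 * int n + 1} \<times> {1, 2, 3 :: int} - {(1, 3)}"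
    show "p \<in> ?f ` ?S"
      by (rule image_eqI[of _ _ "(snd p, nat (2 * int n + 1 - fst p))"]) (use p in \<open>auto simp: stack_def\<close>)
  qed (auto simp: stack_def)
  then show ?thesis
    unfolding B_def path_count_def by (simp only: card_tilings_domino)
qed

lemma T_eq: "T m = cycle_count ({1, 2} \<times> {1, 2}) square_adj (1, 1) (1, 2) (2, 2) (2, 1) m m m m"
proof -
  let ?f = "\<lambda>((x, y), i). (x :: int, y :: int, int i + 1)"
  let ?S = "stack ({1, 2} \<times> {1, 2}) ((\<lambda>_. 0)((1, 1) := m, (1, 2) := m, (2, 2) := m, (2, 1) := m))"
  have "tower m = ?f ` ?S"
  proof (intro equalityI subsetI)
    fix p assume p: "p \<in> tower m"
    obtain x y z where xyz: "p = (x, y, z)" by (cases p)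
    show "p \<in> ?f ` ?S"
      by (rule image_eqI[of _ _ "((x, y), nat (z - 1))"]) (use p xyz in \<open>auto simp: stack_def tower_def\<close>)
  qed (auto simp: stack_def tower_def)
  then show ?thesis
    unfolding T_def cycle_count_def stack_count_def brick_eq
    by (simp only:) (rule card_tilings_image; auto simp: stack_adj_def inj_on_def)
qed

theorem theorem3p2:
  fixes n :: nat
  assumes "n \<ge> 1"
  shows "T (2 * n) = (A n)\<^sup>2 \<and> T (2 * n + 1) = 2 * (B n)\<^sup>2"
proof -
  have B_sum: "B n = (\<Sum>i\<le>n. A i)" for n
    unfolding B_eq A_eq by (rule path_count_notched[OF path3_rows])
  \<comment> \<open>The same grid with a different corner missing: the partial sums do not depend on it.\<close>
  have mirror: "path_count {1, 2, 3} row_adj 1 2 3 (2 * n) (2 * n + 1) (2 * n + 1) = B n" for n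
    using path_count_notched[OF path3_rev[OF path3_rows]]
    by (simp add: B_sum A_eq path_count_rev[OF path3_rows])
  have A_Suc: "A (Suc n) = A n + 2 * (\<Sum>i\<le>n. A i)" for n
    using path_count_full[OF path3_rows, of "2 * n"] mirror[of n] B_eq[of n]
    by (simp add: A_eq[symmetric] B_sum[symmetric]) (simp add: A_eq)
  have A_0: "A 0 = 1"
    using path_count_0[OF path3_rows] by (simp add: A_eq)
  have T_0: "T 0 = 1"
    using cycle_count_0[OF cycle4_square] by (simp add: T_eq)
  have T_1: "T 1 = 2"
    unfolding T_eq using cycle4_square
    by (simp add: cycle_count_peel_first cycle_count_peel_second cycle_count_peel_third cycle_count_peel_fourth cycle_count_0)
  have T_rec: "T (m + 2) = T m + 2 * T (m + 1) + 4 * (\<Sum>i\<le>m. T i)" for m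
    unfolding T_eq by (rule cycle_count_full[OF cycle4_square])
  show ?thesis
    unfolding B_sum by (rule squares_of_recurrence[OF A_0 A_Suc T_0 T_1 T_rec])
qed

end
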